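(* Let $k$ be a positive integer. If the tangent bundle $TS^{2k}$ of the $2k$-sphere is turnable, then the tangent bundle $TS^{2k+1}$ of the $(2k+1)$-sphere is trivial.
   Context: For a real Euclidean vector bundle $E \to B$, an automorphism is a fibrewise isometric bundle isomorphism $E\to E$ covering $\mathrm{id}_B$. A turning of $E$ is a continuous path $(\psi_t)_{t\in[0,1]}$ of automorphisms of $E$ from the identity $\psi_0 = \mathbb{1}_E$ to $\psi_1 = -\mathbb{1}_E$ (the automorphism $v \mapsto -v$). $E$ is turnable if a turning of $E$ exists. *)

theory Defs
  imports "HOL-Analysis.Analysis"
begin

section \<open>Euclidean vector bundles\<close>

text \<open>
  The fibre over \<open>b\<close> consists of the points \<open>e\<close> of the total space with \<open>proj e = b\<close>. The fibrewise
  operations are total functions on the type of points; only their values on points of a common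
  fibre are meaningful.
\<close>

record ('e, 'b) euclidean_bundle =
  total_space :: "'e topology"
  base_space :: "'b topology"
  proj :: "'e \<Rightarrow> 'b"
  fib_add :: "'e \<Rightarrow> 'e \<Rightarrow> 'e"
  fib_scale :: "real \<Rightarrow> 'e \<Rightarrow> 'e"
  fib_inner :: "'e \<Rightarrow> 'e \<Rightarrow> real"

definition same_fibre :: "('e, 'b) euclidean_bundle \<Rightarrow> 'e \<Rightarrow> 'e \<Rightarrow> bool" where
  "same_fibre E e e' \<longleftrightarrow>
     e \<in> topspace (total_space E) \<and> e' \<in> topspace (total_space E) \<and> proj E e = proj E e'"

text \<open>Isomorphisms of vector bundles cover the identity of the base; they need not be isometric.\<close>

definition bundle_iso ::
    "('e, 'b) euclidean_bundle \<Rightarrow> ('f, 'b) euclidean_bundle \<Rightarrow> ('e \<Rightarrow> 'f) \<Rightarrow> bool" where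
  "bundle_iso E F h \<longleftrightarrow>
     base_space E = base_space F \<and>
     homeomorphic_map (total_space E) (total_space F) h \<and>
     (\<forall>e \<in> topspace (total_space E). proj F (h e) = proj E e) \<and>
     (\<forall>e e'. same_fibre E e e' \<longrightarrow> h (fib_add E e e') = fib_add F (h e) (h e')) \<and>
     (\<forall>c. \<forall>e \<in> topspace (total_space E). h (fib_scale E c e) = fib_scale F c (h e))"

definition product_bundle ::
    "'b topology \<Rightarrow> nat \<Rightarrow> ('b \<times> (nat \<Rightarrow> real), 'b) euclidean_bundle" where
  "product_bundle B n =
     \<lparr>total_space = prod_topology B (Euclidean_space n),
      base_space = B,
      proj = fst,
      fib_add = (\<lambda>(x, v) (y, w). (x, \<lambda>i. v i + w i)),
      fib_scale = (\<lambda>c (x, v). (x, \<lambda>i. c * v i)),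
      fib_inner = (\<lambda>(x, v) (y, w). \<Sum>i<n. v i * w i)\<rparr>"

definition trivial_bundle :: "('e, 'b) euclidean_bundle \<Rightarrow> bool" where
  "trivial_bundle E \<longleftrightarrow> (\<exists>n h. bundle_iso E (product_bundle (base_space E) n) h)"

definition restrict_bundle ::
    "('e, 'b) euclidean_bundle \<Rightarrow> 'b set \<Rightarrow> ('e, 'b) euclidean_bundle" where
  "restrict_bundle E U =
     E\<lparr>total_space := subtopology (total_space E) {e. proj E e \<in> U},
       base_space := subtopology (base_space E) U\<rparr>"

text \<open>
  The vector space axioms in the fibres need not be listed: they are transported from
  \<open>\<real>\<^sup>n\<close> by the fibrewise linear bijections that local triviality provides.
\<close>

definition euclidean_vector_bundle :: "('e, 'b) euclidean_bundle \<Rightarrow> bool" where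
  "euclidean_vector_bundle E \<longleftrightarrow>
     continuous_map (total_space E) (base_space E) (proj E) \<and>
     (\<forall>e e'. same_fibre E e e' \<longrightarrow> same_fibre E e (fib_add E e e')) \<and>
     (\<forall>c. \<forall>e \<in> topspace (total_space E). same_fibre E e (fib_scale E c e)) \<and>
     (\<forall>b \<in> topspace (base_space E). \<exists>U. openin (base_space E) U \<and> b \<in> U \<and>
        trivial_bundle (restrict_bundle E U)) \<and>
     (\<forall>e e'. same_fibre E e e' \<longrightarrow> fib_inner E e e' = fib_inner E e' e) \<and>
     (\<forall>e e' e''. same_fibre E e e' \<longrightarrow> same_fibre E e e'' \<longrightarrow>
        fib_inner E (fib_add E e e') e'' = fib_inner E e e'' + fib_inner E e' e'') \<and>
     (\<forall>c e e'. same_fibre E e e' \<longrightarrow> fib_inner E (fib_scale E c e) e' = c * fib_inner E e e') \<and>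
     (\<forall>e \<in> topspace (total_space E). e \<noteq> fib_scale E 0 e \<longrightarrow> fib_inner E e e > 0) \<and>
     continuous_map
       (subtopology (prod_topology (total_space E) (total_space E)) {(e, e'). proj E e = proj E e'})
       euclideanreal (\<lambda>(e, e'). fib_inner E e e')"


section \<open>Turnings\<close>

definition bundle_automorphism :: "('e, 'b) euclidean_bundle \<Rightarrow> ('e \<Rightarrow> 'e) \<Rightarrow> bool" where
  "bundle_automorphism E h \<longleftrightarrow>
     bundle_iso E E h \<and>
     (\<forall>e e'. same_fibre E e e' \<longrightarrow> fib_inner E (h e) (h e') = fib_inner E e e')"

text \<open>
  Continuity of a path of automorphisms means joint continuity of \<open>(t, e) \<mapsto> \<psi> t e\<close>; for locally
  compact total spaces this is continuity for the compact-open topology.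
\<close>

definition turning :: "('e, 'b) euclidean_bundle \<Rightarrow> (real \<Rightarrow> 'e \<Rightarrow> 'e) \<Rightarrow> bool" where
  "turning E \<psi> \<longleftrightarrow>
     (\<forall>t \<in> {0..1}. bundle_automorphism E (\<psi> t)) \<and>
     continuous_map (prod_topology (top_of_set {0..1}) (total_space E)) (total_space E)
       (\<lambda>(t, e). \<psi> t e) \<and>
     (\<forall>e \<in> topspace (total_space E). \<psi> 0 e = e) \<and>
     (\<forall>e \<in> topspace (total_space E). \<psi> 1 e = fib_scale E (-1) e)"

definition turnable :: "('e, 'b) euclidean_bundle \<Rightarrow> bool" where
  "turnable E \<longleftrightarrow> (\<exists>\<psi>. turning E \<psi>)"


section \<open>The tangent bundle of the sphere\<close>

text \<open>
  Tangent vectors to \<open>M\<close> at \<open>x\<close> are velocities of curves in \<open>M\<close> through \<open>x\<close>. For a smooth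
  submanifold \<open>M\<close> it makes no difference that the curves are only required to be differentiable
  at time 0.
\<close>

definition tangent_space :: "(nat \<Rightarrow> real) set \<Rightarrow> (nat \<Rightarrow> real) \<Rightarrow> (nat \<Rightarrow> real) set" where
  "tangent_space M x =
     {v. \<exists>\<gamma>. (\<forall>t. \<gamma> t \<in> M) \<and> \<gamma> 0 = x \<and>
        (\<forall>i. ((\<lambda>t. \<gamma> t i) has_real_derivative v i) (at (0::real)))}"

text \<open>The tangent bundle of \<open>S\<^sup>n \<subseteq> \<real>\<^sup>n\<^sup>+\<^sup>1\<close> with the round metric.\<close>

definition sphere_tangent_bundle ::
    "nat \<Rightarrow> ((nat \<Rightarrow> real) \<times> (nat \<Rightarrow> real), nat \<Rightarrow> real) euclidean_bundle" where
  "sphere_tangent_bundle n =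
     \<lparr>total_space = subtopology (prod_topology (nsphere n) (Euclidean_space (Suc n)))
                      {(x, v). v \<in> tangent_space (topspace (nsphere n)) x},
      base_space = nsphere n,
      proj = fst,
      fib_add = (\<lambda>(x, v) (y, w). (x, \<lambda>i. v i + w i)),
      fib_scale = (\<lambda>c (x, v). (x, \<lambda>i. c * v i)),
      fib_inner = (\<lambda>(x, v) (y, w). \<Sum>i\<le>n. v i * w i)\<rparr>"

lemma topspace_nsphere:
  "topspace (nsphere n) = {x. (\<Sum>i\<le>n. (x i)\<^sup>2) = 1 \<and> (\<forall>i>n. x i = 0)}"
  by (simp add: nsphere)

lemma tangent_space_nsphere:
  assumes x: "x \<in> topspace (nsphere n)"
  shows "tangent_space (topspace (nsphere n)) x =
           {v. (\<Sum>i\<le>n. x i * v i) = 0 \<and> (\<forall>i>n. v i = 0)}"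
proof (intro equalityI subsetI)
  fix v assume "v \<in> tangent_space (topspace (nsphere n)) x"
  then obtain \<gamma> where \<gamma>: "\<And>t. \<gamma> t \<in> topspace (nsphere n)" "\<gamma> 0 = x"
    and d: "\<And>i. ((\<lambda>t. \<gamma> t i) has_real_derivative v i) (at 0)"
    unfolding tangent_space_def by blast
  have s: "(\<Sum>i\<le>n. (\<gamma> t i)\<^sup>2) = 1" and z: "i > n \<Longrightarrow> \<gamma> t i = 0" for t i
    using \<gamma>(1)[of t] by (auto simp: topspace_nsphere)
  have "((\<lambda>t. \<Sum>i\<le>n. (\<gamma> t i)\<^sup>2) has_real_derivative (\<Sum>i\<le>n. 2 * (x i * v i))) (at 0)"
    by (intro DERIV_sum) (auto intro!: derivative_eq_intros d simp: \<gamma>(2))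
  then have "(\<Sum>i\<le>n. 2 * (x i * v i)) = 0"
    using s DERIV_unique[OF _ DERIV_const] by simp
  then have "(\<Sum>i\<le>n. x i * v i) = 0"
    by (simp flip: sum_distrib_left)
  moreover have "v i = 0" if "i > n" for i
    using d[of i] z[OF that] DERIV_unique[OF _ DERIV_const] by simp
  ultimately show "v \<in> {v. (\<Sum>i\<le>n. x i * v i) = 0 \<and> (\<forall>i>n. v i = 0)}"
    by simp
next
  fix v assume "v \<in> {v. (\<Sum>i\<le>n. x i * v i) = 0 \<and> (\<forall>i>n. v i = 0)}"
  then have v: "(\<Sum>i\<le>n. x i * v i) = 0" "\<And>i. i > n \<Longrightarrow> v i = 0" by auto
  have xs: "(\<Sum>i\<le>n. (x i)\<^sup>2) = 1" "\<And>i. i > n \<Longrightarrow> x i = 0"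
    using x by (auto simp: topspace_nsphere)
  define q where "q t = 1 + t\<^sup>2 * (\<Sum>i\<le>n. (v i)\<^sup>2)" for t :: real
  define \<gamma> where "\<gamma> t i = (x i + t * v i) / sqrt (q t)" for t i
  have q: "q t > 0" for t
    unfolding q_def by (intro add_pos_nonneg mult_nonneg_nonneg sum_nonneg) auto
  have "(\<Sum>i\<le>n. (x i + t * v i)\<^sup>2) = q t" for t
  proof -
    have "(\<Sum>i\<le>n. (x i + t * v i)\<^sup>2) =
            (\<Sum>i\<le>n. (x i)\<^sup>2) + 2 * t * (\<Sum>i\<le>n. x i * v i) + t\<^sup>2 * (\<Sum>i\<le>n. (v i)\<^sup>2)"
      by (simp add: power2_eq_square algebra_simps sum.distrib sum_distrib_left)
    then show ?thesis by (simp add: q_def xs v)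
  qed
  then have "(\<Sum>i\<le>n. (\<gamma> t i)\<^sup>2) = 1" for t
    using q[of t] by (simp add: \<gamma>_def power_divide flip: sum_divide_distrib)
  then have "\<forall>t. \<gamma> t \<in> topspace (nsphere n)"
    by (simp add: topspace_nsphere \<gamma>_def xs v)
  moreover have "\<gamma> 0 = x"
    by (simp add: \<gamma>_def q_def fun_eq_iff)
  moreover have "((\<lambda>t. \<gamma> t i) has_real_derivative v i) (at 0)" for i
    unfolding \<gamma>_def q_def by (auto intro!: derivative_eq_intros)
  ultimately show "v \<in> tangent_space (topspace (nsphere n)) x"
    unfolding tangent_space_def by blast
qed

lemma topspace_sphere_tangent_bundle:
  "topspace (total_space (sphere_tangent_bundle n)) =
     {(x, v). x \<in> topspace (nsphere n) \<and> (\<Sum>i\<le>n. x i * v i) = 0 \<and> (\<forall>i>n. v i = 0)}"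
  by (auto simp: sphere_tangent_bundle_def tangent_space_nsphere topspace_Euclidean_space)

lemma continuous_map_Euclidean_space_coord:
  "continuous_map (Euclidean_space n) euclideanreal (\<lambda>v. v i)"
  unfolding Euclidean_space_def
  by (intro continuous_map_from_subtopology continuous_map_product_projection) auto

lemma subtopology_eq_subtopology_topspace:
  "T = subtopology X S \<Longrightarrow> T = subtopology X (topspace T)"
  by (metis subtopology_restrict topspace_subtopology)

lemma subtopology_cong_topspace:
  "topspace X \<inter> S = topspace X \<inter> T \<Longrightarrow> subtopology X S = subtopology X T"
  by (metis subtopology_restrict)

lemma trivial_sphere_tangent_bundle_chart:
  assumes j: "j \<le> n"
  shows "trivial_bundle (restrict_bundle (sphere_tangent_bundle n) {x. x j \<noteq> 0})"
proof -
  let ?E = "restrict_bundle (sphere_tangent_bundle n) {x. x j \<noteq> 0}"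
  let ?F = "product_bundle (base_space ?E) n"
  define del :: "(nat \<Rightarrow> real) \<Rightarrow> nat \<Rightarrow> real"
    where "del v i = (if i < j then v i else v (Suc i))" for v i
  define ins :: "(nat \<Rightarrow> real) \<Rightarrow> nat \<Rightarrow> real"
    where "ins w i = (if i < j then w i else if i = j then 0 else w (i - 1))" for w i
  define lift :: "(nat \<Rightarrow> real) \<Rightarrow> (nat \<Rightarrow> real) \<Rightarrow> nat \<Rightarrow> real"
    where "lift x w i = (if i = j then - (\<Sum>l\<in>{..n} - {j}. x l * ins w l) / x j else ins w i)" for x w i
  have split: "(\<Sum>l\<le>n. f l) = f j + (\<Sum>l\<in>{..n} - {j}. f l)" for f :: "nat \<Rightarrow> real"
    using j by (simp add: sum.remove)
  have lift_tan: "(\<Sum>l\<le>n. x l * lift x w l) = 0" if "x j \<noteq> 0" for x w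
    using that by (simp add: split lift_def)
  have ins_del: "ins (del v) i = v i" if "i \<noteq> j" for v i
    using that by (auto simp: ins_def del_def)
  have lift_del: "lift x (del v) = v" if "x j \<noteq> 0" "(\<Sum>l\<le>n. x l * v l) = 0" for x v
  proof
    fix i
    have "(\<Sum>l\<in>{..n} - {j}. x l * ins (del v) l) = (\<Sum>l\<in>{..n} - {j}. x l * v l)"
      by (rule sum.cong) (auto simp: ins_del)
    then show "lift x (del v) i = v i"
      using that by (simp add: lift_def ins_del split field_simps)
  qed
  have del_lift: "del (lift x w) = w" for x w
    by (auto simp: del_def lift_def ins_def fun_eq_iff)
  have tE: "topspace (total_space ?E) = {(x, v). x \<in> topspace (nsphere n) \<and> x j \<noteq> 0 \<and>
              (\<Sum>i\<le>n. x i * v i) = 0 \<and> (\<forall>i>n. v i = 0)}"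
    using topspace_sphere_tangent_bundle[of n]
    by (auto simp: restrict_bundle_def sphere_tangent_bundle_def)
  have tF: "topspace (total_space ?F) = {(x, w). x \<in> topspace (nsphere n) \<and> x j \<noteq> 0 \<and> (\<forall>i\<ge>n. w i = 0)}"
    by (auto simp: restrict_bundle_def sphere_tangent_bundle_def product_bundle_def
        topspace_Euclidean_space)
  have E: "total_space ?E = subtopology (prod_topology (nsphere n) (Euclidean_space (Suc n)))
                              (topspace (total_space ?E))"
    by (rule subtopology_eq_subtopology_topspace[where S = "{(x, v). v \<in> tangent_space (topspace (nsphere n)) x} \<inter> {e. fst e j \<noteq> 0}"])
       (simp add: restrict_bundle_def sphere_tangent_bundle_def subtopology_subtopology)
  have F: "total_space ?F = subtopology (prod_topology (nsphere n) (Euclidean_space n))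
                              (topspace (total_space ?F))"
    by (rule subtopology_eq_subtopology_topspace[where S = "{x. x j \<noteq> 0} \<times> topspace (Euclidean_space n)"])
       (simp add: restrict_bundle_def sphere_tangent_bundle_def product_bundle_def
          prod_topology_subtopology)
  have x_cont: "continuous_map (total_space ?E) euclideanreal (\<lambda>e. fst e i)"
    and v_cont: "continuous_map (total_space ?E) euclideanreal (\<lambda>e. snd e i)"
    and fst_cont: "continuous_map (total_space ?E) (nsphere n) fst" for i
    by (subst E, rule continuous_map_from_subtopology,
        use continuous_map_compose[OF continuous_map_fst continuous_map_nsphere_projection]
          continuous_map_compose[OF continuous_map_snd continuous_map_Euclidean_space_coord]
          continuous_map_fst in \<open>force simp: o_def\<close>)+
  have x_cont': "continuous_map (total_space ?F) euclideanreal (\<lambda>e. fst e i)"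
    and w_cont: "continuous_map (total_space ?F) euclideanreal (\<lambda>e. snd e i)"
    and fst_cont': "continuous_map (total_space ?F) (nsphere n) fst" for i
    by (subst F, rule continuous_map_from_subtopology,
        use continuous_map_compose[OF continuous_map_fst continuous_map_nsphere_projection]
          continuous_map_compose[OF continuous_map_snd continuous_map_Euclidean_space_coord]
          continuous_map_fst in \<open>force simp: o_def\<close>)+
  let ?h = "\<lambda>e. (fst e, del (snd e))"
  let ?g = "\<lambda>e. (fst e, lift (fst e) (snd e))"
  have h_in: "?h e \<in> topspace (total_space ?F)" if "e \<in> topspace (total_space ?E)" for e
    using that j unfolding tE tF by (auto simp: del_def)
  have g_in: "?g e \<in> topspace (total_space ?E)" if "e \<in> topspace (total_space ?F)" for e
  proof -
    have "lift x w i = 0" if "\<forall>i\<ge>n. w i = 0" "i > n" for x w i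
      using that j by (auto simp: lift_def ins_def)
    then show ?thesis
      using that lift_tan unfolding tE tF by auto
  qed
  have "continuous_map (total_space ?E) (total_space ?F) ?h"
  proof (subst F, unfold continuous_map_in_subtopology, intro conjI)
    have "continuous_map (total_space ?E) euclideanreal (\<lambda>e. del (snd e) i)" for i
      unfolding del_def using v_cont by (cases "i < j") auto
    then have "continuous_map (total_space ?E) (Euclidean_space n) (\<lambda>e. del (snd e))"
      unfolding Euclidean_space_def continuous_map_in_subtopology continuous_map_componentwise_UNIV
      using h_in unfolding tF by auto
    then show "continuous_map (total_space ?E) (prod_topology (nsphere n) (Euclidean_space n)) ?h"
      using fst_cont by (simp add: continuous_map_pairwise o_def eta_contract_eq)
    show "?h \<in> topspace (total_space ?E) \<rightarrow> topspace (total_space ?F)"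
      using h_in by blast
  qed
  moreover have "continuous_map (total_space ?F) (total_space ?E) ?g"
  proof (subst E, unfold continuous_map_in_subtopology, intro conjI)
    have ins_cont: "continuous_map (total_space ?F) euclideanreal (\<lambda>e. ins (snd e) i)" for i
      unfolding ins_def using w_cont by (cases "i < j"; cases "i = j") auto
    have "continuous_map (total_space ?F) euclideanreal (\<lambda>e. lift (fst e) (snd e) i)" for i
    proof (cases "i = j")
      case True
      have "continuous_map (total_space ?F) euclideanreal
              (\<lambda>e. - (\<Sum>l\<in>{..n} - {j}. fst e l * ins (snd e) l) / fst e j)"
        by (intro continuous_intros x_cont' ins_cont) (auto simp: tF)
      then show ?thesis using True by (simp add: lift_def)
    qed (simp add: lift_def ins_cont)
    then have "continuous_map (total_space ?F) (Euclidean_space (Suc n)) (\<lambda>e. lift (fst e) (snd e))"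
      unfolding Euclidean_space_def continuous_map_in_subtopology continuous_map_componentwise_UNIV
      using g_in unfolding tE by (auto simp: Suc_le_eq)
    then show "continuous_map (total_space ?F) (prod_topology (nsphere n) (Euclidean_space (Suc n))) ?g"
      using fst_cont' by (simp add: continuous_map_pairwise o_def)
    show "?g \<in> topspace (total_space ?F) \<rightarrow> topspace (total_space ?E)"
      using g_in by blast
  qed
  moreover have "\<forall>e \<in> topspace (total_space ?E). ?g (?h e) = e"
    unfolding tE by (auto simp: lift_del)
  moreover have "\<forall>e \<in> topspace (total_space ?F). ?h (?g e) = e"
    by (simp add: del_lift)
  ultimately have "homeomorphic_map (total_space ?E) (total_space ?F) ?h"
    unfolding homeomorphic_map_maps homeomorphic_maps_def by blast
  then have "bundle_iso ?E ?F ?h"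
    unfolding bundle_iso_def
    by (auto simp: restrict_bundle_def sphere_tangent_bundle_def product_bundle_def same_fibre_def
        del_def fun_eq_iff)
  then show ?thesis
    unfolding trivial_bundle_def by blast
qed

lemma euclidean_vector_bundle_sphere_tangent_bundle:
  "euclidean_vector_bundle (sphere_tangent_bundle n)" (is "euclidean_vector_bundle ?E")
proof -
  have t: "topspace (total_space ?E) = {(x, v). x \<in> topspace (nsphere n) \<and>
              (\<Sum>i\<le>n. x i * v i) = 0 \<and> (\<forall>i>n. v i = 0)}"
    by (rule topspace_sphere_tangent_bundle)
  have v_cont: "continuous_map (total_space ?E) euclideanreal (\<lambda>e. snd e i)"
    and fst_cont: "continuous_map (total_space ?E) (nsphere n) fst" for i
    unfolding sphere_tangent_bundle_def euclidean_bundle.simps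
    by (rule continuous_map_from_subtopology,
        use continuous_map_compose[OF continuous_map_snd continuous_map_Euclidean_space_coord]
          continuous_map_fst in \<open>force simp: o_def\<close>)+
  have triv: "\<exists>U. openin (nsphere n) U \<and> b \<in> U \<and> trivial_bundle (restrict_bundle ?E U)"
    if b: "b \<in> topspace (nsphere n)" for b
  proof -
    obtain j where j: "j \<le> n" "b j \<noteq> 0"
    proof -
      have "\<not> (\<forall>j\<le>n. b j = 0)"
      proof
        assume "\<forall>j\<le>n. b j = 0"
        then have "(\<Sum>i\<le>n. (b i)\<^sup>2) = 0" by simp
        then show False using b by (simp add: topspace_nsphere)
      qed
      then show thesis using that by blast
    qed
    let ?U = "{x \<in> topspace (nsphere n). x j \<in> - {0}}"
    have "openin (nsphere n) ?U"
      by (rule openin_continuous_map_preimage[OF continuous_map_nsphere_projection]) auto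
    moreover have "restrict_bundle ?E ?U = restrict_bundle ?E {x. x j \<noteq> 0}"
    proof -
      have "subtopology (total_space ?E) {e. proj ?E e \<in> ?U} =
              subtopology (total_space ?E) {e. proj ?E e \<in> {x. x j \<noteq> 0}}"
        by (rule subtopology_cong_topspace) (auto simp: t, auto simp: sphere_tangent_bundle_def)
      moreover have "subtopology (base_space ?E) ?U = subtopology (base_space ?E) {x. x j \<noteq> 0}"
        by (rule subtopology_cong_topspace) (auto simp: sphere_tangent_bundle_def)
      ultimately show ?thesis
        by (simp add: restrict_bundle_def)
    qed
    ultimately show ?thesis
      using trivial_sphere_tangent_bundle_chart[OF j(1)] b j(2) by (intro exI[of _ ?U]) auto
  qed
  have pos: "fib_inner ?E e e > 0"
    if e: "e \<in> topspace (total_space ?E)" "e \<noteq> fib_scale ?E 0 e" for e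
  proof -
    obtain x v where [simp]: "e = (x, v)" by fastforce
    obtain i where i: "v i \<noteq> 0" "i \<le> n"
    proof -
      have "\<exists>i. v i \<noteq> 0"
        using e(2) by (auto simp: sphere_tangent_bundle_def fun_eq_iff)
      then show thesis
        using that e(1) unfolding t by (auto simp: not_le[symmetric])
    qed
    then have "(\<Sum>i\<le>n. v i * v i) > 0"
      by (intro sum_pos2[of _ i]) (auto simp: zero_less_mult_iff linorder_neq_iff)
    then show ?thesis by (simp add: sphere_tangent_bundle_def)
  qed
  have inner_cont: "continuous_map
       (subtopology (prod_topology (total_space ?E) (total_space ?E)) {(e, e'). proj ?E e = proj ?E e'})
       euclideanreal (\<lambda>(e, e'). fib_inner ?E e e')"
  proof (rule continuous_map_from_subtopology)
    have "continuous_map (prod_topology (total_space ?E) (total_space ?E)) euclideanreal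
            (\<lambda>p. \<Sum>i\<le>n. snd (fst p) i * snd (snd p) i)"
      using continuous_map_compose[OF continuous_map_fst v_cont]
        continuous_map_compose[OF continuous_map_snd v_cont]
      by (intro continuous_intros) (auto simp: o_def)
    then show "continuous_map (prod_topology (total_space ?E) (total_space ?E)) euclideanreal
            (\<lambda>(e, e'). fib_inner ?E e e')"
      by (simp add: sphere_tangent_bundle_def case_prod_unfold)
  qed
  have add: "same_fibre ?E e (fib_add ?E e e')" if "same_fibre ?E e e'" for e e'
    using that unfolding same_fibre_def t
    by (auto simp: sphere_tangent_bundle_def distrib_left sum.distrib)
  have scale: "same_fibre ?E e (fib_scale ?E c e)" if "e \<in> topspace (total_space ?E)" for c e
    using that unfolding same_fibre_def t
    by (auto simp: sphere_tangent_bundle_def mult.left_commute[of _ c] simp flip: sum_distrib_left)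
  have proj: "continuous_map (total_space ?E) (base_space ?E) (proj ?E)"
    using fst_cont by (simp add: sphere_tangent_bundle_def)
  have inner_sym: "fib_inner ?E e e' = fib_inner ?E e' e" for e e'
    by (simp add: sphere_tangent_bundle_def case_prod_unfold mult.commute)
  have inner_add: "fib_inner ?E (fib_add ?E e e') e'' = fib_inner ?E e e'' + fib_inner ?E e' e''"
    for e e' e''
    by (simp add: sphere_tangent_bundle_def case_prod_unfold distrib_right sum.distrib)
  have inner_scale: "fib_inner ?E (fib_scale ?E c e) e' = c * fib_inner ?E e e'" for c e e'
    by (simp add: sphere_tangent_bundle_def case_prod_unfold sum_distrib_left mult.assoc)
  have base: "base_space ?E = nsphere n"
    by (simp add: sphere_tangent_bundle_def)
  show ?thesis
    unfolding euclidean_vector_bundle_def base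
    by (intro conjI ballI allI impI)
       (assumption | rule triv pos inner_cont add scale proj[unfolded base] inner_sym inner_add inner_scale)+
qed

end

theory Submission
  imports Defs
begin

text \<open>
  The tangent bundle of \<open>S\<^sup>n\<^sup>+\<^sup>1 \<subseteq> \<real>\<^sup>n\<^sup>+\<^sup>2\<close> is trivial over the complement of each pole. Write a
  point as \<open>y = (y', c)\<close> with \<open>c\<close> its last coordinate. Reflecting \<open>y\<close> to a pole identifies the tangent
  space at \<open>y\<close> with \<open>\<real>\<^sup>n\<^sup>+\<^sup>1\<close>, and this gives frames \<open>P\<^sub>+\<close> where \<open>c > -1\<close> and \<open>P\<^sub>-\<close> where \<open>c < 1\<close>
  (\<open>pole_frame\<close>). At a point \<open>x\<close> of the equator, \<open>P\<^sub>- = R\<^sub>x P\<^sub>+\<close>, where \<open>R\<^sub>x\<close> is the reflection of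
  \<open>\<real>\<^sup>n\<^sup>+\<^sup>1\<close> that negates \<open>x\<close> (\<open>pole_frame_transition\<close>). So \<open>x \<mapsto> R\<^sub>x\<close> is a clutching function of the
  bundle, and after replacing \<open>P\<^sub>-\<close> by \<open>-P\<^sub>-\<close> the clutching function becomes \<open>x \<mapsto> -R\<^sub>x\<close>, which is \<open>-1\<close>
  on the tangent space of \<open>S\<^sup>n\<close> at \<open>x\<close> and \<open>1\<close> on the normal line through \<open>x\<close>.

  A turning \<open>\<psi>\<close> of \<open>TS\<^sup>n\<close>, extended by the identity on the normal lines (\<open>stabilise\<close>), is a homotopy of
  maps from \<open>S\<^sup>n\<close> to the orthogonal group that joins the constant map \<open>1\<close> to \<open>x \<mapsto> -R\<^sub>x\<close>. It therefore
  trivialises \<open>TS\<^sup>n\<^sup>+\<^sup>1\<close>: take \<open>-P\<^sub>-\<close> on the lower hemisphere, \<open>P\<^sub>+\<close> near the upper pole, and in the band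
  between them compose \<open>P\<^sub>+\<close> with the homotopy, run along the meridians (\<open>turned_frame\<close>).
\<close>

section \<open>Linear isometries between subspaces of coordinate space\<close>

definition dot :: "nat \<Rightarrow> (nat \<Rightarrow> real) \<Rightarrow> (nat \<Rightarrow> real) \<Rightarrow> real" where
  "dot n u v = (\<Sum>i<n. u i * v i)"

lemma dot_commute: "dot n u v = dot n v u"
  by (simp add: dot_def mult.commute)

lemma dot_add_left: "dot n (\<lambda>i. u i + v i) w = dot n u w + dot n v w"
  by (simp add: dot_def algebra_simps sum.distrib)

lemma dot_diff_left: "dot n (\<lambda>i. u i - v i) w = dot n u w - dot n v w"
  by (simp add: dot_def algebra_simps sum_subtractf)

lemma dot_minus_left: "dot n (\<lambda>i. - u i) w = - dot n u w"
  by (simp add: dot_def sum_negf)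

lemma dot_scale_left: "dot n (\<lambda>i. c * u i) w = c * dot n u w"
  by (simp add: dot_def algebra_simps sum_distrib_left)

lemma dot_add_right: "dot n w (\<lambda>i. u i + v i) = dot n w u + dot n w v"
  by (simp add: dot_def algebra_simps sum.distrib)

lemma dot_diff_right: "dot n w (\<lambda>i. u i - v i) = dot n w u - dot n w v"
  by (simp add: dot_def algebra_simps sum_subtractf)

lemma dot_minus_right: "dot n w (\<lambda>i. - u i) = - dot n w u"
  by (simp add: dot_def sum_negf)

lemma dot_scale_right: "dot n w (\<lambda>i. c * u i) = c * dot n w u"
  by (simp add: dot_def algebra_simps sum_distrib_left)

lemmas dot_bilinear = dot_add_left dot_diff_left dot_minus_left dot_scale_left
  dot_add_right dot_diff_right dot_minus_right dot_scale_right

lemma dot_Suc: "dot (Suc n) u v = dot n u v + u n * v n"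
  by (simp add: dot_def)

lemma dot_cong:
  "(\<And>i. i < n \<Longrightarrow> u i = u' i) \<Longrightarrow> (\<And>i. i < n \<Longrightarrow> v i = v' i) \<Longrightarrow> dot n u v = dot n u' v'"
  by (simp add: dot_def)

lemma dot_unit: "j < n \<Longrightarrow> dot n u (\<lambda>i. if i = j then 1 else 0) = u j"
  by (simp add: dot_def if_distrib cong: if_cong)

text \<open>
  The inner product is taken in \<open>m\<close> coordinates on \<open>V\<close> and in \<open>n\<close> coordinates on \<open>W\<close>, so that \<open>V\<close> can be a
  tangent hyperplane and \<open>W\<close> a coordinate space of one dimension less.
\<close>

definition isometry_onto ::
    "nat \<Rightarrow> nat \<Rightarrow> (nat \<Rightarrow> real) set \<Rightarrow> (nat \<Rightarrow> real) set \<Rightarrow> ((nat \<Rightarrow> real) \<Rightarrow> nat \<Rightarrow> real) \<Rightarrow> bool" where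
  "isometry_onto m n V W f \<longleftrightarrow>
     f ` V = W \<and>
     (\<forall>u\<in>V. \<forall>v\<in>V. f (\<lambda>i. u i + v i) = (\<lambda>i. f u i + f v i)) \<and>
     (\<forall>c. \<forall>v\<in>V. f (\<lambda>i. c * v i) = (\<lambda>i. c * f v i)) \<and>
     (\<forall>u\<in>V. \<forall>v\<in>V. dot n (f u) (f v) = dot m u v)"

lemma isometry_onto_comp:
  assumes f: "isometry_onto l m U V f" and g: "isometry_onto m n V W g"
  shows "isometry_onto l n U W (\<lambda>u. g (f u))"
proof -
  have V: "f u \<in> V" if "u \<in> U" for u
    using f that by (auto simp: isometry_onto_def)
  have "(\<lambda>u. g (f u)) ` U = W"
    using f g by (auto simp: isometry_onto_def)
  then show ?thesis
    using f g V by (simp add: isometry_onto_def)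
qed

lemma isometry_onto_uminus:
  assumes f: "isometry_onto m n V (topspace (Euclidean_space n)) f"
  shows "isometry_onto m n V (topspace (Euclidean_space n)) (\<lambda>v i. - f v i)"
proof -
  have "w \<in> (\<lambda>v i. - f v i) ` V" if "\<forall>i\<ge>n. w i = 0" for w
  proof -
    have "(\<lambda>i. - w i) \<in> f ` V"
      using f that by (auto simp: isometry_onto_def topspace_Euclidean_space)
    then obtain v where "v \<in> V" "(\<lambda>i. - w i) = f v" by blast
    then show ?thesis
      by (intro image_eqI[of _ _ v]) (simp_all add: fun_eq_iff, metis minus_minus)
  qed
  moreover have "f v i = 0" if "v \<in> V" "i \<ge> n" for v i
    using f that by (auto simp: isometry_onto_def topspace_Euclidean_space)
  ultimately have "(\<lambda>v i. - f v i) ` V = topspace (Euclidean_space n)"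
    by (auto simp: topspace_Euclidean_space)
  then show ?thesis
    using f by (auto simp: isometry_onto_def dot_bilinear)
qed


section \<open>Trivialising the tangent bundle of a sphere\<close>

lemma mem_nsphere_iff:
  "x \<in> topspace (nsphere n) \<longleftrightarrow> dot (Suc n) x x = 1 \<and> (\<forall>i\<ge>Suc n. x i = 0)"
  by (auto simp: topspace_nsphere dot_def lessThan_Suc_atMost power2_eq_square Suc_le_eq)

lemma mem_tangent_space_iff:
  assumes "x \<in> topspace (nsphere n)"
  shows "v \<in> tangent_space (topspace (nsphere n)) x \<longleftrightarrow> dot (Suc n) x v = 0 \<and> (\<forall>i\<ge>Suc n. v i = 0)"
  using assms by (auto simp: tangent_space_nsphere dot_def lessThan_Suc_atMost Suc_le_eq)

lemma sphere_tangent_bundle_sel: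
  "base_space (sphere_tangent_bundle n) = nsphere n"
  "proj (sphere_tangent_bundle n) = fst"
  "fib_add (sphere_tangent_bundle n) = (\<lambda>(x, v) (y, w). (x, \<lambda>i. v i + w i))"
  "fib_scale (sphere_tangent_bundle n) = (\<lambda>c (x, v). (x, \<lambda>i. c * v i))"
  "fib_inner (sphere_tangent_bundle n) = (\<lambda>(x, v) (y, w). dot (Suc n) v w)"
  by (auto simp: sphere_tangent_bundle_def dot_def lessThan_Suc_atMost)

lemma mem_sphere_tangent_bundle_iff:
  "(x, v) \<in> topspace (total_space (sphere_tangent_bundle n)) \<longleftrightarrow>
     x \<in> topspace (nsphere n) \<and> dot (Suc n) x v = 0 \<and> (\<forall>i\<ge>Suc n. v i = 0)"
  by (auto simp: topspace_sphere_tangent_bundle dot_def lessThan_Suc_atMost Suc_le_eq)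

lemma continuous_map_into_Euclidean_space:
  "continuous_map X (Euclidean_space n) f \<longleftrightarrow>
     (\<forall>i. continuous_map X euclideanreal (\<lambda>x. f x i)) \<and> (\<forall>x\<in>topspace X. \<forall>i\<ge>n. f x i = 0)"
  unfolding Euclidean_space_def continuous_map_in_subtopology continuous_map_componentwise_UNIV
  by auto

lemma continuous_map_into_nsphere:
  "continuous_map X (nsphere n) f \<longleftrightarrow>
     (\<forall>i. continuous_map X euclideanreal (\<lambda>x. f x i)) \<and> (\<forall>x\<in>topspace X. f x \<in> topspace (nsphere n))"
  (is "?l \<longleftrightarrow> ?r")
proof
  assume ?l
  then show ?r
    using continuous_map_compose[OF \<open>?l\<close> continuous_map_nsphere_projection]
    by (auto simp: o_def continuous_map_def)
next
  assume r: ?r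
  have "continuous_map X (Euclidean_space (Suc n)) f"
    using r by (auto simp: continuous_map_into_Euclidean_space mem_nsphere_iff)
  then show ?l
    using r unfolding nsphere by (auto simp: continuous_map_in_subtopology)
qed

lemma continuous_map_into_sphere_tangent_bundle:
  "continuous_map X (total_space (sphere_tangent_bundle n)) (\<lambda>x. (f x, g x)) \<longleftrightarrow>
     (\<forall>i. continuous_map X euclideanreal (\<lambda>x. f x i)) \<and>
     (\<forall>i. continuous_map X euclideanreal (\<lambda>x. g x i)) \<and>
     (\<forall>x\<in>topspace X. (f x, g x) \<in> topspace (total_space (sphere_tangent_bundle n)))"
  unfolding sphere_tangent_bundle_def euclidean_bundle.simps continuous_map_in_subtopology
    continuous_map_pairwise
  by (auto simp: o_def continuous_map_into_nsphere continuous_map_into_Euclidean_space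
      mem_tangent_space_iff topspace_Euclidean_space)

lemma continuous_map_sphere_tangent_bundle_coords:
  "continuous_map (total_space (sphere_tangent_bundle n)) euclideanreal (\<lambda>e. fst e i)"
  "continuous_map (total_space (sphere_tangent_bundle n)) euclideanreal (\<lambda>e. snd e i)"
  using continuous_map_into_sphere_tangent_bundle[of "total_space (sphere_tangent_bundle n)" n fst snd]
  by simp_all

lemma continuous_map_dot:
  assumes "\<And>i. i < n \<Longrightarrow> continuous_map X euclideanreal (\<lambda>x. f x i)"
    and "\<And>i. i < n \<Longrightarrow> continuous_map X euclideanreal (\<lambda>x. g x i)"
  shows "continuous_map X euclideanreal (\<lambda>x. dot n (f x) (g x))"
  unfolding dot_def using assms by (intro continuous_intros) auto

definition tangent_part :: "nat \<Rightarrow> (nat \<Rightarrow> real) \<Rightarrow> (nat \<Rightarrow> real) \<Rightarrow> nat \<Rightarrow> real" where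
  "tangent_part n x u = (\<lambda>i. u i - dot (Suc n) x u * x i)"

lemma tangent_part_mem:
  assumes "x \<in> topspace (nsphere n)" "\<forall>i\<ge>Suc n. u i = 0"
  shows "(x, tangent_part n x u) \<in> topspace (total_space (sphere_tangent_bundle n))"
  using assms by (simp add: mem_sphere_tangent_bundle_iff tangent_part_def dot_bilinear mem_nsphere_iff)

text \<open>
  The inverse of a continuous family of linear isometries is continuous because it is the family of
  adjoints: the \<open>j\<close>-th coordinate of the adjoint at \<open>w\<close> is the inner product of \<open>w\<close> with the image of
  the tangential part of the \<open>j\<close>-th unit vector.
\<close>

lemma trivial_sphere_tangent_bundleI:
  assumes cont: "continuous_map (total_space (sphere_tangent_bundle n)) (Euclidean_space n) (\<lambda>e. f (fst e) (snd e))"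
    and iso: "\<And>x. x \<in> topspace (nsphere n) \<Longrightarrow>
      isometry_onto (Suc n) n (tangent_space (topspace (nsphere n)) x) (topspace (Euclidean_space n)) (f x)"
  shows "trivial_bundle (sphere_tangent_bundle n)"
proof -
  let ?E = "sphere_tangent_bundle n" and ?F = "product_bundle (nsphere n) n"
  let ?T = "\<lambda>x. tangent_space (topspace (nsphere n)) x"
  define unit :: "nat \<Rightarrow> nat \<Rightarrow> real" where "unit j i = (if i = j then 1 else 0)" for j i
  define h where "h e = (fst e, f (fst e) (snd e))" for e
  define adj where "adj x w j = (if j < Suc n then dot n w (f x (tangent_part n x (unit j))) else 0)" for x w j
  define g where "g e = (fst e, adj (fst e) (snd e))" for e
  have unit_tan: "(x, tangent_part n x (unit j)) \<in> topspace (total_space ?E)"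
    if "x \<in> topspace (nsphere n)" "j < Suc n" for x j
    using that by (intro tangent_part_mem) (auto simp: unit_def)
  have tE: "(x, v) \<in> topspace (total_space ?E) \<longleftrightarrow> x \<in> topspace (nsphere n) \<and> v \<in> ?T x" for x v
    by (auto simp: mem_sphere_tangent_bundle_iff mem_tangent_space_iff)
  have F: "total_space ?F = prod_topology (nsphere n) (Euclidean_space n)"
    by (simp add: product_bundle_def)
  have adj_f: "adj x (f x v) = v" if x: "x \<in> topspace (nsphere n)" and v: "v \<in> ?T x" for x v
  proof
    fix j
    show "adj x (f x v) j = v j"
    proof (cases "j < Suc n")
      case True
      have "dot n (f x v) (f x (tangent_part n x (unit j))) = dot (Suc n) v (tangent_part n x (unit j))"
        using iso[OF x] v unit_tan[OF x True] unfolding isometry_onto_def tE by blast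
      also have "\<dots> = v j - dot (Suc n) x (unit j) * dot (Suc n) v x"
        using True by (simp add: tangent_part_def dot_bilinear dot_unit unit_def)
      also have "\<dots> = v j"
        using v x by (simp add: mem_tangent_space_iff dot_commute)
      finally show ?thesis using True by (simp add: adj_def)
    next
      case False
      then show ?thesis using v x by (simp add: adj_def mem_tangent_space_iff)
    qed
  qed
  have onto: "\<exists>v\<in>?T x. w = f x v" if "x \<in> topspace (nsphere n)" "w \<in> topspace (Euclidean_space n)" for x w
    using iso[OF that(1)] that(2) unfolding isometry_onto_def by blast
  have gh: "g (h e) = e" if "e \<in> topspace (total_space ?E)" for e
    using that by (cases e) (simp add: g_def h_def adj_f tE)
  have g_onto: "\<exists>e'\<in>topspace (total_space ?E). e = h e'" if "e \<in> topspace (total_space ?F)" for e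
  proof -
    have e: "fst e \<in> topspace (nsphere n)" "snd e \<in> topspace (Euclidean_space n)"
      using that by (auto simp: F)
    then obtain v where "v \<in> ?T (fst e)" "snd e = f (fst e) v"
      using onto by blast
    then show ?thesis
      using e by (intro bexI[of _ "(fst e, v)"]) (auto simp: F h_def tE prod_eq_iff)
  qed
  have hg: "h (g e) = e" and g_in: "g e \<in> topspace (total_space ?E)" if "e \<in> topspace (total_space ?F)" for e
    using g_onto[OF that] gh by auto
  have h_cont: "continuous_map (total_space ?E) (total_space ?F) h"
    using cont continuous_map_sphere_tangent_bundle_coords[of n]
    unfolding F h_def continuous_map_pairwise
    by (auto simp: o_def continuous_map_into_nsphere continuous_map_into_Euclidean_space tE)
  have x_cont: "continuous_map (total_space ?F) euclideanreal (\<lambda>e. fst e i)"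
    and w_cont: "continuous_map (total_space ?F) euclideanreal (\<lambda>e. snd e i)" for i
    unfolding F
    using continuous_map_compose[OF continuous_map_fst continuous_map_nsphere_projection]
          continuous_map_compose[OF continuous_map_snd continuous_map_Euclidean_space_coord]
    by (force simp: o_def)+
  have col_cont: "continuous_map (total_space ?F) euclideanreal (\<lambda>e. f (fst e) (tangent_part n (fst e) (unit j)) i)"
    if j: "j < Suc n" for i j
  proof -
    have "continuous_map (total_space ?F) (total_space ?E) (\<lambda>e. (fst e, tangent_part n (fst e) (unit j)))"
      unfolding continuous_map_into_sphere_tangent_bundle
      using unit_tan[OF _ j]
      by (auto simp: F tangent_part_def intro!: continuous_intros x_cont[unfolded F] continuous_map_dot)
    from continuous_map_compose[OF this cont] show ?thesis
      by (simp add: o_def continuous_map_into_Euclidean_space)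
  qed
  have "continuous_map (total_space ?F) euclideanreal (\<lambda>e. adj (fst e) (snd e) j)" for j
    by (cases "j < Suc n") (auto simp: adj_def intro!: continuous_map_dot w_cont col_cont)
  then have g_cont: "continuous_map (total_space ?F) (total_space ?E) g"
    using x_cont g_in unfolding g_def continuous_map_into_sphere_tangent_bundle by auto
  have "homeomorphic_map (total_space ?E) (total_space ?F) h"
    using h_cont g_cont gh hg unfolding homeomorphic_map_maps homeomorphic_maps_def by blast
  moreover have "f x (\<lambda>i. u i + v i) = (\<lambda>i. f x u i + f x v i)"
    if "x \<in> topspace (nsphere n)" "u \<in> ?T x" "v \<in> ?T x" for x u v
    using iso[OF that(1)] that unfolding isometry_onto_def by blast
  moreover have "f x (\<lambda>i. c * v i) = (\<lambda>i. c * f x v i)"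
    if "x \<in> topspace (nsphere n)" "v \<in> ?T x" for x v c
    using iso[OF that(1)] that unfolding isometry_onto_def by blast
  ultimately have "bundle_iso ?E (product_bundle (base_space ?E) n) h"
    unfolding bundle_iso_def same_fibre_def
    by (auto simp: tE h_def[abs_def] product_bundle_def sphere_tangent_bundle_sel)
  then show ?thesis
    unfolding trivial_bundle_def by blast
qed


section \<open>Frames off a pole\<close>

text \<open>
  Let \<open>N\<close> be the last unit vector and \<open>s = \<plusminus>1\<close>. The reflection in the hyperplane orthogonal to
  \<open>y + s N\<close> takes \<open>y\<close> to \<open>-s N\<close>, hence vectors tangent at \<open>y\<close> to vectors with last coordinate 0. On
  tangent vectors it is given by the formula below, which breaks down only at \<open>y = -s N\<close>.
\<close>

definition pole_frame :: "nat \<Rightarrow> real \<Rightarrow> (nat \<Rightarrow> real) \<Rightarrow> (nat \<Rightarrow> real) \<Rightarrow> nat \<Rightarrow> real" where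
  "pole_frame n s y v = (\<lambda>i. if i < n then v i - s * v n / (1 + s * y n) * y i else 0)"

lemma pole_frame_isometry:
  assumes y: "y \<in> topspace (nsphere n)" and s: "s\<^sup>2 = 1" and pole: "1 + s * y n \<noteq> 0"
  shows "isometry_onto (Suc n) n (tangent_space (topspace (nsphere n)) y)
           (topspace (Euclidean_space n)) (pole_frame n s y)"
proof -
  let ?T = "tangent_space (topspace (nsphere n)) y"
  define k where "k = s / (1 + s * y n)"
  have yy: "dot n y y = 1 - (y n)\<^sup>2"
    using y by (simp add: mem_nsphere_iff dot_Suc power2_eq_square)
  have tan: "v \<in> ?T \<longleftrightarrow> dot n y v = - y n * v n \<and> (\<forall>i\<ge>Suc n. v i = 0)" for v
    using y by (auto simp: mem_tangent_space_iff dot_Suc)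
  have P: "pole_frame n s y v = (\<lambda>i. if i < n then v i - k * v n * y i else 0)" for v
    by (simp add: pole_frame_def k_def fun_eq_iff)
  have dotP: "dot n (pole_frame n s y u) w = dot n u w - k * u n * dot n y w" for u w
  proof -
    have "dot n (pole_frame n s y u) w = dot n (\<lambda>i. u i - k * u n * y i) w"
      by (rule dot_cong) (auto simp: P)
    then show ?thesis by (simp add: dot_bilinear)
  qed
  have dotP': "dot n w (pole_frame n s y v) = dot n w v - k * v n * dot n w y" for v w
    using dotP[of v w] by (simp add: dot_commute)
  have k: "2 * k * y n + k\<^sup>2 * (1 - (y n)\<^sup>2) = 1"
  proof -
    have "1 - (y n)\<^sup>2 = (1 - s * y n) * (1 + s * y n)"
      using s by (simp add: algebra_simps power2_eq_square)
    moreover have "2 * k * y n = 2 * (s * y n) / (1 + s * y n)"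
      by (simp add: k_def)
    moreover have "k\<^sup>2 = 1 / (1 + s * y n)\<^sup>2"
      using s by (simp add: k_def power_divide)
    ultimately have "2 * k * y n + k\<^sup>2 * (1 - (y n)\<^sup>2) = 2 * (s * y n) / (1 + s * y n) + (1 - s * y n) / (1 + s * y n)"
      by (simp add: power2_eq_square[of "1 + s * y n"])
    also have "\<dots> = (1 + s * y n) / (1 + s * y n)"
      unfolding add_divide_distrib[symmetric] by simp
    finally show ?thesis using pole by simp
  qed
  have inner: "dot n (pole_frame n s y u) (pole_frame n s y v) = dot (Suc n) u v" if "u \<in> ?T" "v \<in> ?T" for u v
  proof -
    have "dot n (pole_frame n s y u) (pole_frame n s y v)
        = dot n u v - k * v n * dot n u y - k * u n * (dot n y v - k * v n * dot n y y)"
      by (simp add: dotP dotP' algebra_simps)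
    also have "\<dots> = dot n u v + (2 * k * y n + k\<^sup>2 * (1 - (y n)\<^sup>2)) * (u n * v n)"
      using that by (simp add: dot_commute[of n u y] tan yy algebra_simps power2_eq_square)
    finally show ?thesis by (simp add: k dot_Suc)
  qed
  have onto: "w \<in> pole_frame n s y ` ?T" if w: "\<forall>i\<ge>n. w i = 0" for w
  proof -
    \<comment> \<open>Reflections are involutions, so the preimage of \<open>(w, 0)\<close> is its own reflection.\<close>
    define v where "v i = (if i < n then w i - dot n y w / (1 + s * y n) * y i
      else if i = n then - s * dot n y w else 0)" for i
    have "dot n y v = dot n y (\<lambda>i. w i - dot n y w / (1 + s * y n) * y i)"
      by (rule dot_cong) (auto simp: v_def)
    also have "\<dots> = dot n y w * (1 - (1 - (y n)\<^sup>2) / (1 + s * y n))"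
      unfolding dot_diff_right dot_scale_right yy by (simp add: right_diff_distrib diff_divide_distrib)
    also have "1 - (y n)\<^sup>2 = (1 - s * y n) * (1 + s * y n)"
      using s by (simp add: algebra_simps power2_eq_square)
    finally have "dot n y v = dot n y w * (s * y n)"
      using pole by simp
    moreover have "v n = - s * dot n y w" "\<forall>i\<ge>Suc n. v i = 0"
      by (simp_all add: v_def)
    ultimately have "v \<in> ?T" by (simp add: tan)
    moreover have "pole_frame n s y v = w"
    proof
      fix i
      show "pole_frame n s y v i = w i"
        using w s by (simp add: pole_frame_def v_def power2_eq_square flip: mult.assoc)
    qed
    ultimately show ?thesis by blast
  qed
  have "pole_frame n s y ` ?T = topspace (Euclidean_space n)"
    using onto by (auto simp: topspace_Euclidean_space pole_frame_def)
  then show ?thesis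
    using inner by (auto simp: isometry_onto_def P algebra_simps)
qed

text \<open>The point of the equator on the meridian through \<open>y\<close>; it has no continuous extension to the poles.\<close>

definition equator_point :: "nat \<Rightarrow> (nat \<Rightarrow> real) \<Rightarrow> nat \<Rightarrow> real" where
  "equator_point n y = (\<lambda>i. if i < n then y i / sqrt (1 - (y n)\<^sup>2) else 0)"

lemma equator_point_mem:
  assumes y: "y \<in> topspace (nsphere (Suc n))" and c: "(y (Suc n))\<^sup>2 < 1"
  shows "equator_point (Suc n) y \<in> topspace (nsphere n)"
proof -
  let ?s = "sqrt (1 - (y (Suc n))\<^sup>2)"
  have "dot (Suc n) (equator_point (Suc n) y) (equator_point (Suc n) y)
      = dot (Suc n) (\<lambda>i. inverse ?s * y i) (\<lambda>i. inverse ?s * y i)"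
    by (rule dot_cong) (auto simp: equator_point_def field_simps)
  also have "\<dots> = dot (Suc n) y y / ?s\<^sup>2"
    unfolding dot_scale_left dot_scale_right by (simp add: power2_eq_square field_simps)
  also have "dot (Suc n) y y = ?s\<^sup>2"
    using y c by (simp add: mem_nsphere_iff dot_Suc[of "Suc n"] power2_eq_square)
  finally show ?thesis
    using c by (simp add: mem_nsphere_iff) (simp add: equator_point_def)
qed

text \<open>
  The two frames at an equatorial point \<open>x\<close> differ by the reflection of \<open>\<real>\<^sup>n\<^sup>+\<^sup>1\<close> that negates \<open>x\<close>: the
  difference of the frames is a multiple of \<open>x\<close>, and the component of the frame along \<open>x\<close> is, up to
  sign, the last coordinate of the tangent vector.
\<close>

lemma pole_frame_transition:
  assumes y: "y \<in> topspace (nsphere (Suc n))" and c: "y (Suc n) = 0"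
    and v: "v \<in> tangent_space (topspace (nsphere (Suc n))) y"
  shows "pole_frame (Suc n) (-1) y v i =
    pole_frame (Suc n) 1 y v i
     - 2 * dot (Suc n) (equator_point (Suc n) y) (pole_frame (Suc n) 1 y v) * equator_point (Suc n) y i"
proof -
  have "dot (Suc n) (equator_point (Suc n) y) (pole_frame (Suc n) 1 y v)
      = dot (Suc n) y (\<lambda>i. v i - v (Suc n) * y i)"
    using c by (intro dot_cong) (auto simp: pole_frame_def equator_point_def)
  also have "\<dots> = - v (Suc n)"
    using y v c by (simp add: dot_bilinear mem_tangent_space_iff) (simp add: mem_nsphere_iff dot_Suc[of "Suc n"])
  finally show ?thesis
    using c by (simp add: pole_frame_def equator_point_def)
qed


section \<open>From a turning to a framing\<close>

text \<open>
  \<open>\<real>\<^sup>n\<^sup>+\<^sup>1\<close> is the sum of the tangent space of \<open>S\<^sup>n\<close> at \<open>x\<close> and the normal line through \<open>x\<close>. An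
  automorphism of the tangent bundle is extended by the identity on the normal line; in particular
  \<open>-1\<close> becomes minus the reflection that negates \<open>x\<close>.
\<close>

definition stabilise :: "nat \<Rightarrow> ((nat \<Rightarrow> real) \<times> (nat \<Rightarrow> real) \<Rightarrow> (nat \<Rightarrow> real) \<times> (nat \<Rightarrow> real)) \<Rightarrow>
    (nat \<Rightarrow> real) \<Rightarrow> (nat \<Rightarrow> real) \<Rightarrow> nat \<Rightarrow> real" where
  "stabilise n \<phi> x u = (\<lambda>i. snd (\<phi> (x, tangent_part n x u)) i + dot (Suc n) x u * x i)"

lemma stabilise_isometry:
  assumes \<phi>: "bundle_automorphism (sphere_tangent_bundle n) \<phi>" and x: "x \<in> topspace (nsphere n)"
  shows "isometry_onto (Suc n) (Suc n) (topspace (Euclidean_space (Suc n)))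
    (topspace (Euclidean_space (Suc n))) (stabilise n \<phi> x)"
proof -
  let ?E = "sphere_tangent_bundle n" and ?R = "topspace (Euclidean_space (Suc n))"
  define T where "T = tangent_space (topspace (nsphere n)) x"
  define f where "f v = snd (\<phi> (x, v))" for v
  have T: "v \<in> T \<longleftrightarrow> dot (Suc n) x v = 0 \<and> (\<forall>i\<ge>Suc n. v i = 0)" for v
    using x by (simp add: T_def mem_tangent_space_iff)
  have E: "(x, v) \<in> topspace (total_space ?E) \<longleftrightarrow> v \<in> T" for v
    using x by (simp add: mem_sphere_tangent_bundle_iff T)
  have homeo: "homeomorphic_map (total_space ?E) (total_space ?E) \<phi>"
    and fst_\<phi>: "\<And>e. e \<in> topspace (total_space ?E) \<Longrightarrow> fst (\<phi> e) = fst e"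
    and add: "\<And>e e'. same_fibre ?E e e' \<Longrightarrow> \<phi> (fib_add ?E e e') = fib_add ?E (\<phi> e) (\<phi> e')"
    and scale: "\<And>c e. e \<in> topspace (total_space ?E) \<Longrightarrow> \<phi> (fib_scale ?E c e) = fib_scale ?E c (\<phi> e)"
    and inner: "\<And>e e'. same_fibre ?E e e' \<Longrightarrow> fib_inner ?E (\<phi> e) (\<phi> e') = fib_inner ?E e e'"
    using \<phi> unfolding bundle_automorphism_def bundle_iso_def by (auto simp: sphere_tangent_bundle_sel)
  have onto: "\<phi> ` topspace (total_space ?E) = topspace (total_space ?E)"
    using homeo by (rule homeomorphic_imp_surjective_map)
  have \<phi>: "\<phi> (x, v) = (x, f v)" if "v \<in> T" for v
    using fst_\<phi>[of "(x, v)"] that by (simp add: E f_def prod_eq_iff)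
  have f_T: "f v \<in> T" if "v \<in> T" for v
    using onto that \<phi>[OF that] E by (metis image_eqI)
  have f_add: "f (\<lambda>i. u i + v i) = (\<lambda>i. f u i + f v i)" if "u \<in> T" "v \<in> T" for u v
    using add[of "(x, u)" "(x, v)"] that by (simp add: same_fibre_def E sphere_tangent_bundle_sel \<phi>) (simp add: f_def)
  have f_scale: "f (\<lambda>i. c * v i) = (\<lambda>i. c * f v i)" if "v \<in> T" for c v
    using scale[of "(x, v)" c] that by (simp add: E sphere_tangent_bundle_sel \<phi>) (simp add: f_def)
  have f_inner: "dot (Suc n) (f u) (f v) = dot (Suc n) u v" if "u \<in> T" "v \<in> T" for u v
    using inner[of "(x, u)" "(x, v)"] that by (simp add: same_fibre_def E sphere_tangent_bundle_sel \<phi>)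
  have f_onto: "\<exists>v\<in>T. w = f v" if "w \<in> T" for w
  proof -
    have "(x, w) \<in> \<phi> ` topspace (total_space ?E)"
      using that by (simp add: onto E)
    then obtain e where e: "e \<in> topspace (total_space ?E)" "(x, w) = \<phi> e" by blast
    then have "e = (x, snd e)"
      using fst_\<phi>[of e] by (metis fst_conv prod.collapse)
    then show ?thesis
      using e E[of "snd e"] by (intro bexI[of _ "snd e"]) (auto simp: f_def dest: sym)
  qed
  have xx: "dot (Suc n) x x = 1" and x0: "\<And>i. i \<ge> Suc n \<Longrightarrow> x i = 0"
    using x by (auto simp: mem_nsphere_iff)
  have R: "u \<in> ?R \<longleftrightarrow> (\<forall>i\<ge>Suc n. u i = 0)" for u
    by (auto simp: topspace_Euclidean_space)
  have p_T: "tangent_part n x u \<in> T" if "u \<in> ?R" for u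
    using that by (simp add: R T tangent_part_def dot_bilinear xx x0)
  have S: "stabilise n \<phi> x u = (\<lambda>i. f (tangent_part n x u) i + dot (Suc n) x u * x i)" for u
    by (simp add: stabilise_def f_def)
  \<comment> \<open>In the decomposition into tangential and normal part, the map is \<open>f\<close> plus the identity.\<close>
  have S_T: "stabilise n \<phi> x (\<lambda>i. v i + a * x i) = (\<lambda>i. f v i + a * x i)" if "v \<in> T" for v a
    using that by (simp add: S tangent_part_def T dot_bilinear xx)
  have decomp: "\<exists>v\<in>T. \<exists>a. u = (\<lambda>i. v i + a * x i)" if "u \<in> ?R" for u
    using p_T[OF that] by (intro bexI exI) (auto simp: tangent_part_def)
  have add_T: "(\<lambda>i. u i + v i) \<in> T" and scale_T: "(\<lambda>i. c * v i) \<in> T" if "u \<in> T" "v \<in> T" for u v c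
    using that by (simp_all add: T dot_bilinear)
  have "stabilise n \<phi> x ` ?R = ?R"
  proof (intro equalityI subsetI)
    fix w assume "w \<in> stabilise n \<phi> x ` ?R"
    then obtain u where u: "u \<in> ?R" "w = stabilise n \<phi> x u" by blast
    then show "w \<in> ?R"
      using f_T[OF p_T[OF u(1)]] by (auto simp: R S T x0)
  next
    fix w assume "w \<in> ?R"
    then obtain v a where v: "v \<in> T" "w = (\<lambda>i. v i + a * x i)" using decomp by blast
    then obtain u where u: "u \<in> T" "v = f u" using f_onto by blast
    have "w = stabilise n \<phi> x (\<lambda>i. u i + a * x i)"
      using u v by (simp add: S_T)
    moreover have "(\<lambda>i. u i + a * x i) \<in> ?R"
      using u by (auto simp: R T x0)
    ultimately show "w \<in> stabilise n \<phi> x ` ?R" by blast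
  qed
  moreover have "stabilise n \<phi> x (\<lambda>i. u i + u' i) = (\<lambda>i. stabilise n \<phi> x u i + stabilise n \<phi> x u' i)"
    if "u \<in> ?R" "u' \<in> ?R" for u u'
  proof -
    obtain v a v' a' where v: "v \<in> T" "u = (\<lambda>i. v i + a * x i)" "v' \<in> T" "u' = (\<lambda>i. v' i + a' * x i)"
      using decomp[OF \<open>u \<in> ?R\<close>] decomp[OF \<open>u' \<in> ?R\<close>] by blast
    have "stabilise n \<phi> x (\<lambda>i. u i + u' i) = stabilise n \<phi> x (\<lambda>i. (v i + v' i) + (a + a') * x i)"
      by (simp add: v algebra_simps)
    also have "\<dots> = (\<lambda>i. f (\<lambda>i. v i + v' i) i + (a + a') * x i)"
      using v by (intro S_T add_T)
    finally show ?thesis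
      using v by (simp add: S_T f_add algebra_simps)
  qed
  moreover have "stabilise n \<phi> x (\<lambda>i. c * u i) = (\<lambda>i. c * stabilise n \<phi> x u i)" if "u \<in> ?R" for c u
  proof -
    obtain v a where v: "v \<in> T" "u = (\<lambda>i. v i + a * x i)"
      using decomp[OF \<open>u \<in> ?R\<close>] by blast
    have "stabilise n \<phi> x (\<lambda>i. c * u i) = stabilise n \<phi> x (\<lambda>i. c * v i + (c * a) * x i)"
      by (simp add: v algebra_simps)
    also have "\<dots> = (\<lambda>i. f (\<lambda>i. c * v i) i + (c * a) * x i)"
      using v by (intro S_T scale_T)
    finally show ?thesis
      using v by (simp add: S_T f_scale algebra_simps)
  qed
  moreover have "dot (Suc n) (stabilise n \<phi> x u) (stabilise n \<phi> x u') = dot (Suc n) u u'"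
    if "u \<in> ?R" "u' \<in> ?R" for u u'
  proof -
    obtain v a v' a' where v: "v \<in> T" "u = (\<lambda>i. v i + a * x i)" "v' \<in> T" "u' = (\<lambda>i. v' i + a' * x i)"
      using decomp[OF \<open>u \<in> ?R\<close>] decomp[OF \<open>u' \<in> ?R\<close>] by blast
    have "dot (Suc n) (f v) x = 0" "dot (Suc n) v x = 0" "dot (Suc n) x (f v') = 0" "dot (Suc n) x v' = 0"
      using f_T v by (auto simp: T dot_commute[of _ _ x])
    then show ?thesis
      using v by (simp add: S_T dot_bilinear f_inner xx)
  qed
  ultimately show ?thesis
    unfolding isometry_onto_def by blast
qed

text \<open>
  The turning is run from its end at height 0 to its start at height 1/2. Any height strictly between
  0 and 1 would do instead of 1/2: the turned band has to stay away from the upper pole, where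
  \<open>equator_point\<close> is discontinuous.
\<close>

definition turned_frame :: "nat \<Rightarrow> (real \<Rightarrow> (nat \<Rightarrow> real) \<times> (nat \<Rightarrow> real) \<Rightarrow> (nat \<Rightarrow> real) \<times> (nat \<Rightarrow> real)) \<Rightarrow>
    (nat \<Rightarrow> real) \<Rightarrow> (nat \<Rightarrow> real) \<Rightarrow> nat \<Rightarrow> real" where
  "turned_frame n \<psi> y v =
     (if y (Suc n) \<le> 0 then (\<lambda>i. - pole_frame (Suc n) (-1) y v i)
      else if y (Suc n) \<le> 1/2 then
        stabilise n (\<psi> (1 - 2 * y (Suc n))) (equator_point (Suc n) y) (pole_frame (Suc n) 1 y v)
      else pole_frame (Suc n) 1 y v)"

lemma turned_frame_isometry:
  assumes \<psi>: "turning (sphere_tangent_bundle n) \<psi>" and y: "y \<in> topspace (nsphere (Suc n))"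
  shows "isometry_onto (Suc (Suc n)) (Suc n) (tangent_space (topspace (nsphere (Suc n))) y)
    (topspace (Euclidean_space (Suc n))) (turned_frame n \<psi> y)"
proof -
  consider "y (Suc n) \<le> 0" | "0 < y (Suc n)" "y (Suc n) \<le> 1/2" | "1/2 < y (Suc n)" by linarith
  then show ?thesis
  proof cases
    case 1
    then show ?thesis
      using isometry_onto_uminus[OF pole_frame_isometry[OF y, of "-1"]]
      by (simp add: turned_frame_def[abs_def])
  next
    case 2
    then have "(y (Suc n))\<^sup>2 < 1"
      using power_mono[of "y (Suc n)" "1/2" 2] by (simp add: power2_eq_square)
    then have x: "equator_point (Suc n) y \<in> topspace (nsphere n)"
      by (rule equator_point_mem[OF y])
    have "bundle_automorphism (sphere_tangent_bundle n) (\<psi> (1 - 2 * y (Suc n)))"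
      using \<psi> 2 by (simp add: turning_def)
    from isometry_onto_comp[OF pole_frame_isometry[OF y, of 1] stabilise_isometry[OF this x]]
    show ?thesis
      using 2 by (simp add: turned_frame_def[abs_def])
  next
    case 3
    then show ?thesis
      using pole_frame_isometry[OF y, of 1] by (simp add: turned_frame_def[abs_def])
  qed
qed

text \<open>
  Each piece is continuous, so only the two seams matter. At height 1/2 the turning is the identity.
  At height 0 it is \<open>-1\<close> on tangent vectors of the equator, and its stabilisation cancels the
  reflection between the two frames up to the sign that the lower frame carries.
\<close>

lemma turned_frame_continuous:
  assumes \<psi>: "turning (sphere_tangent_bundle n) \<psi>"
  shows "continuous_map (total_space (sphere_tangent_bundle (Suc n))) (Euclidean_space (Suc n))
    (\<lambda>e. turned_frame n \<psi> (fst e) (snd e))"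
proof -
  let ?E = "total_space (sphere_tangent_bundle n)"
  let ?E' = "total_space (sphere_tangent_bundle (Suc n))"
  let ?c = "\<lambda>e::(nat \<Rightarrow> real) \<times> (nat \<Rightarrow> real). fst e (Suc n)"
  let ?P = "\<lambda>s e. pole_frame (Suc n) s (fst e) (snd e)"
  let ?x = "\<lambda>e::(nat \<Rightarrow> real) \<times> (nat \<Rightarrow> real). equator_point (Suc n) (fst e)"
  let ?S = "\<lambda>e. stabilise n (\<psi> (1 - 2 * ?c e)) (?x e) (?P 1 e)"
  have sph: "fst e \<in> topspace (nsphere (Suc n))" "snd e \<in> tangent_space (topspace (nsphere (Suc n))) (fst e)"
    if "e \<in> topspace ?E'" for e
    using that by (cases e; simp add: mem_sphere_tangent_bundle_iff mem_tangent_space_iff)+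
  have coords: "continuous_map (subtopology ?E' A) euclideanreal (\<lambda>e. fst e i)"
      "continuous_map (subtopology ?E' A) euclideanreal (\<lambda>e. snd e i)" for A i
    using continuous_map_sphere_tangent_bundle_coords by (auto intro: continuous_map_from_subtopology)
  have P_coord: "continuous_map (subtopology ?E' A) euclideanreal (\<lambda>e. ?P s e i)"
    if "\<And>e. e \<in> topspace ?E' \<Longrightarrow> e \<in> A \<Longrightarrow> 1 + s * ?c e \<noteq> 0" for A s i
    using that by (cases "i < Suc n") (auto simp: pole_frame_def intro!: continuous_intros coords)
  have P_cont: "continuous_map (subtopology ?E' A) (Euclidean_space (Suc n)) (?P s)"
    if "\<And>e. e \<in> topspace ?E' \<Longrightarrow> e \<in> A \<Longrightarrow> 1 + s * ?c e \<noteq> 0" for A s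
    using P_coord[OF that] by (auto simp: continuous_map_into_Euclidean_space pole_frame_def)
  define B where "B = {e. 0 \<le> ?c e \<and> ?c e \<le> 1/2}"
  have B: "(?c e)\<^sup>2 < 1" if "e \<in> B" for e
    using that power_mono[of "?c e" "1/2" 2] by (simp add: B_def power2_eq_square)
  have x_in: "?x e \<in> topspace (nsphere n)" if "e \<in> topspace ?E'" "e \<in> B" for e
    using equator_point_mem[OF sph(1)] B that by blast
  have S_cont: "continuous_map (subtopology ?E' B) (Euclidean_space (Suc n)) ?S"
  proof -
    let ?X = "subtopology ?E' B"
    have x_coord: "continuous_map ?X euclideanreal (\<lambda>e. ?x e i)" for i
      using B by (cases "i < Suc n")
        (auto simp: equator_point_def intro!: continuous_intros coords, force)
    have P1: "continuous_map ?X euclideanreal (\<lambda>e. ?P 1 e i)" for i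
      by (rule P_coord) (auto simp: B_def)
    have dot: "continuous_map ?X euclideanreal (\<lambda>e. dot (Suc n) (?x e) (?P 1 e))"
      by (intro continuous_map_dot x_coord P1)
    have "continuous_map ?X ?E (\<lambda>e. (?x e, tangent_part n (?x e) (?P 1 e)))"
      unfolding continuous_map_into_sphere_tangent_bundle
      using x_in by (auto simp: tangent_part_def[abs_def] intro!: continuous_intros x_coord P1 dot)
        (auto simp flip: tangent_part_def intro!: tangent_part_mem simp: pole_frame_def)
    moreover have "continuous_map ?X (top_of_set {0..1}) (\<lambda>e. 1 - 2 * ?c e)"
      unfolding continuous_map_in_subtopology
      by (auto simp: B_def intro!: continuous_intros coords)
    ultimately have "continuous_map ?X (prod_topology (top_of_set {0..1}) ?E)
        (\<lambda>e. (1 - 2 * ?c e, (?x e, tangent_part n (?x e) (?P 1 e))))"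
      by (simp add: continuous_map_pairwise o_def)
    moreover have "continuous_map (prod_topology (top_of_set {0..1}) ?E) ?E (\<lambda>(t, e). \<psi> t e)"
      using \<psi> by (simp add: turning_def)
    ultimately have "continuous_map ?X ?E (\<lambda>e. \<psi> (1 - 2 * ?c e) (?x e, tangent_part n (?x e) (?P 1 e)))"
      by (auto dest: continuous_map_compose simp: o_def)
    from continuous_map_compose[OF this continuous_map_sphere_tangent_bundle_coords(2)]
    have "continuous_map ?X euclideanreal (\<lambda>e. ?S e i)" for i
      by (auto simp: stabilise_def o_def intro!: continuous_intros dot x_coord)
    moreover have "?S e i = 0" if "e \<in> topspace ?X" "i \<ge> Suc n" for e i
    proof -
      have e: "e \<in> topspace ?E'" "e \<in> B" using that by auto
      have aut: "bundle_automorphism (sphere_tangent_bundle n) (\<psi> (1 - 2 * ?c e))"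
        using \<psi> e by (simp add: turning_def B_def)
      have "?P 1 e \<in> topspace (Euclidean_space (Suc n))"
        by (simp add: topspace_Euclidean_space pole_frame_def)
      then have "?S e \<in> topspace (Euclidean_space (Suc n))"
        using stabilise_isometry[OF aut x_in[OF e]] unfolding isometry_onto_def by blast
      then show ?thesis using that by (simp add: topspace_Euclidean_space)
    qed
    ultimately show ?thesis
      by (simp add: continuous_map_into_Euclidean_space)
  qed
  have stab0: "?S e = ?P 1 e" if e: "e \<in> topspace ?E'" and c: "?c e = 1/2" for e
  proof -
    have "(?x e, tangent_part n (?x e) (?P 1 e)) \<in> topspace ?E"
      using e c by (intro tangent_part_mem x_in) (auto simp: B_def pole_frame_def)
    then have "\<psi> 0 (?x e, tangent_part n (?x e) (?P 1 e)) = (?x e, tangent_part n (?x e) (?P 1 e))"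
      using \<psi> unfolding turning_def by blast
    then show ?thesis
      unfolding stabilise_def c by (simp add: tangent_part_def)
  qed
  have stab1: "?S e = (\<lambda>i. - ?P (-1) e i)" if e: "e \<in> topspace ?E'" and c: "?c e = 0" for e
  proof
    fix i
    have "(?x e, tangent_part n (?x e) (?P 1 e)) \<in> topspace ?E"
      using e c by (intro tangent_part_mem x_in) (auto simp: B_def pole_frame_def)
    then have "\<psi> 1 (?x e, tangent_part n (?x e) (?P 1 e)) = (?x e, \<lambda>i. - tangent_part n (?x e) (?P 1 e) i)"
      using \<psi> by (simp add: turning_def sphere_tangent_bundle_sel)
    then have "?S e i = - (?P 1 e i - 2 * dot (Suc n) (?x e) (?P 1 e) * ?x e i)"
      using c by (simp add: stabilise_def tangent_part_def)
    also have "\<dots> = - ?P (-1) e i"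
      using pole_frame_transition[OF sph(1)[OF e] c sph(2)[OF e], of i] by simp
    finally show "?S e i = - ?P (-1) e i" .
  qed
  let ?U = "{e \<in> topspace ?E'. 0 \<le> ?c e}"
  have upper: "continuous_map (subtopology ?E' ?U) (Euclidean_space (Suc n))
      (\<lambda>e. if ?c e \<le> 1/2 then ?S e else ?P 1 e)"
  proof (rule continuous_map_cases_le)
    have "continuous_map (subtopology ?E' ({e. 0 \<le> ?c e \<and> ?c e \<le> 1/2})) (Euclidean_space (Suc n)) ?S"
      using S_cont by (simp add: B_def)
    then show "continuous_map (subtopology (subtopology ?E' ?U) {e \<in> topspace (subtopology ?E' ?U). ?c e \<le> 1/2})
        (Euclidean_space (Suc n)) ?S"
      by (auto simp: subtopology_subtopology elim!: continuous_map_from_subtopology_mono)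
    show "continuous_map (subtopology (subtopology ?E' ?U) {e \<in> topspace (subtopology ?E' ?U). 1/2 \<le> ?c e})
        (Euclidean_space (Suc n)) (?P 1)"
      unfolding subtopology_subtopology by (rule P_cont) auto
    show "?S e = ?P 1 e" if "e \<in> topspace (subtopology ?E' ?U)" "?c e = 1/2" for e
      using stab0 that by auto
  qed (auto intro: coords)
  have "continuous_map ?E' (Euclidean_space (Suc n))
      (\<lambda>e. if ?c e \<le> 0 then (\<lambda>i. - ?P (-1) e i) else if ?c e \<le> 1/2 then ?S e else ?P 1 e)"
  proof (rule continuous_map_cases_le)
    have "continuous_map (subtopology ?E' {e \<in> topspace ?E'. ?c e \<le> 0}) (Euclidean_space (Suc n)) (?P (-1))"
      by (rule P_cont) auto
    then show "continuous_map (subtopology ?E' {e \<in> topspace ?E'. ?c e \<le> 0}) (Euclidean_space (Suc n))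
        (\<lambda>e i. - ?P (-1) e i)"
      by (simp add: continuous_map_into_Euclidean_space)
    show "(\<lambda>i. - ?P (-1) e i) = (if ?c e \<le> 1/2 then ?S e else ?P 1 e)"
      if "e \<in> topspace ?E'" "?c e = 0" for e
      using stab1[OF that] that by simp
  qed (use upper continuous_map_sphere_tangent_bundle_coords in auto)
  then show ?thesis
    by (simp add: turned_frame_def[abs_def])
qed

theorem theorem1p2:
  fixes k :: nat
  assumes "k > 0"
    and "turnable (sphere_tangent_bundle (2 * k))"
  shows "trivial_bundle (sphere_tangent_bundle (2 * k + 1))"
proof -
  obtain \<psi> where "turning (sphere_tangent_bundle (2 * k)) \<psi>"
    using assms(2) unfolding turnable_def by blast
  then have "trivial_bundle (sphere_tangent_bundle (Suc (2 * k)))"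
    by (intro trivial_sphere_tangent_bundleI[OF turned_frame_continuous turned_frame_isometry])
  then show ?thesis by simp
qed

end
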